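(* Let $\mathcal{A},\mathcal{B},\mathcal{C}$ be unital $C^*$-algebras, let $\xi:\mathcal{B}\to\mathcal{C}$ be a positive linear map (not necessarily unital nor Schwarz-positive), let $F:\mathcal{B}\to\mathcal{A}$ be a Schwarz-positive unital (SPU) map, and suppose there exists an SPU map $G:\mathcal{A}\to\mathcal{B}$ such that $G\circ F$ is $\xi$-a.e. equivalent to $\mathrm{id}_{\mathcal{B}}$. Then, for all $B\in\mathcal{B}$, $$\xi(B^*B)=\xi\Big(G\big(F(B)\big)^*G\big(F(B)\big)\Big)=\xi\Big(G\big(F(B)^*F(B)\big)\Big)=\xi\Big(G\big(F(B^*B)\big)\Big).$$
   Context: A linear map $F:\mathcal{B}\to\mathcal{A}$ of unital $C^*$-algebras is Schwarz-positive unital (SPU) if it is unital and $F(B^*B)\ge F(B)^*F(B)$ for all $B\in\mathcal{B}$. Linear maps $H,K:\mathcal{B}\to\mathcal{B}$ are $\xi$-a.e. equivalent if $\xi(H(B)B')=\xi(K(B)B')$ and $\xi(B'H(B))=\xi(B'K(B))$ for all $B,B'\in\mathcal{B}$ (the two conditions are equivalent for $*$-preserving maps). *)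

theory Defs
  imports "HOL-Analysis.Analysis"
begin

text \<open>
  The class \<^class>\<open>monoid_mult\<close> rather than a class extending ring_1 supplies the unit, so that the zero
  algebra (where 1 = 0) is not excluded. The real structure inherited from the library classes is
  tied to the complex one by scaleR_scaleC.
\<close>

class unital_cstar_algebra = real_normed_algebra + banach + monoid_mult +
  fixes scaleC :: "complex \<Rightarrow> 'a \<Rightarrow> 'a" (infixr "*\<^sub>C" 75)
    and adj :: "'a \<Rightarrow> 'a" ("(_\<^sup>\<star>)" [1000] 1000)
  assumes scaleR_scaleC: "r *\<^sub>R x = complex_of_real r *\<^sub>C x"
    and scaleC_add_right: "c *\<^sub>C (x + y) = c *\<^sub>C x + c *\<^sub>C y"
    and scaleC_add_left: "(c + d) *\<^sub>C x = c *\<^sub>C x + d *\<^sub>C x"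
    and scaleC_scaleC: "c *\<^sub>C (d *\<^sub>C x) = (c * d) *\<^sub>C x"
    and mult_scaleC_left: "(c *\<^sub>C x) * y = c *\<^sub>C (x * y)"
    and mult_scaleC_right: "x * (c *\<^sub>C y) = c *\<^sub>C (x * y)"
    and norm_scaleC: "norm (c *\<^sub>C x) = cmod c * norm x"
    and adj_adj: "(x\<^sup>\<star>)\<^sup>\<star> = x"
    and adj_add: "(x + y)\<^sup>\<star> = x\<^sup>\<star> + y\<^sup>\<star>"
    and adj_scaleC: "(c *\<^sub>C x)\<^sup>\<star> = cnj c *\<^sub>C x\<^sup>\<star>"
    and adj_mult: "(x * y)\<^sup>\<star> = y\<^sup>\<star> * x\<^sup>\<star>"
    and cstar_identity: "norm (x\<^sup>\<star> * x) = (norm x)\<^sup>2"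

lemma vector_space_scaleC:
  "vector_space (scaleC :: complex \<Rightarrow> 'a \<Rightarrow> 'a::unital_cstar_algebra)"
proof
  show "1 *\<^sub>C x = x" for x :: 'a
    using scaleR_scaleC[of 1 x] by simp
qed (simp_all add: scaleC_add_right scaleC_add_left scaleC_scaleC)

abbreviation clinear :: "('a::unital_cstar_algebra \<Rightarrow> 'b::unital_cstar_algebra) \<Rightarrow> bool" where
  "clinear \<equiv> Vector_Spaces.linear scaleC scaleC"

definition positive_elem :: "'a::unital_cstar_algebra \<Rightarrow> bool" where
  "positive_elem a \<longleftrightarrow> (\<exists>b. a = b\<^sup>\<star> * b)"

text \<open>The order is not installed as an instance of \<^class>\<open>ord\<close>, to avoid clashing with
  existing orders on instance types.\<close>

definition cstar_le :: "'a::unital_cstar_algebra \<Rightarrow> 'a \<Rightarrow> bool" (infix "\<sqsubseteq>" 50) where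
  "a \<sqsubseteq> b \<longleftrightarrow> positive_elem (b - a)"

definition positive_linear_map ::
    "('a::unital_cstar_algebra \<Rightarrow> 'b::unital_cstar_algebra) \<Rightarrow> bool" where
  "positive_linear_map f \<longleftrightarrow> clinear f \<and> (\<forall>a. positive_elem a \<longrightarrow> positive_elem (f a))"

definition SPU :: "('a::unital_cstar_algebra \<Rightarrow> 'b::unital_cstar_algebra) \<Rightarrow> bool" where
  "SPU F \<longleftrightarrow> clinear F \<and> F 1 = 1 \<and> (\<forall>B. (F B)\<^sup>\<star> * F B \<sqsubseteq> F (B\<^sup>\<star> * B))"

definition ae_equiv ::
    "('b::unital_cstar_algebra \<Rightarrow> 'c::unital_cstar_algebra) \<Rightarrow> ('b \<Rightarrow> 'b) \<Rightarrow> ('b \<Rightarrow> 'b) \<Rightarrow> bool" where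
  "ae_equiv \<xi> H K \<longleftrightarrow>
     (\<forall>B B'. \<xi> (H B * B') = \<xi> (K B * B') \<and> \<xi> (B' * H B) = \<xi> (B' * K B))"

end

theory Submission
  imports Defs
begin

text \<open>
  Almost everywhere equivalence gives $\xi(B^*B) = \xi(G(F(B))^*G(F(B))) = \xi(G(F(B^*B)))$, because
  $G \circ F$ preserves adjoints. The two Schwarz inequalities write the difference of the outer
  terms as a sum of three elements $\xi(b^*b)$, so in $\mathcal{C}$ one has
  $x^*x + y^*y + z^*z = 0$, and every summand must vanish.

  For the last point the elements $b^*b$ are shown to lie in a pointed convex cone, without spectral
  theory. The cone is that of the self-adjoint $a$ with $\|t - a\| \le t$ for some $t$, which makes
  closure under sums the triangle inequality; the binomial series of $\sqrt{1 - h}$ identifies it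
  with the set of squares of self-adjoint elements.
\<close>

interpretation scaleC: vector_space "scaleC :: complex \<Rightarrow> 'a \<Rightarrow> 'a::unital_cstar_algebra"
  by (rule vector_space_scaleC)

section \<open>Adjoints\<close>

lemma adj_zero [simp]: "0\<^sup>\<star> = (0::'a::unital_cstar_algebra)"
  using adj_add[of 0 "0::'a"] by simp

lemma adj_one [simp]: "1\<^sup>\<star> = (1::'a::unital_cstar_algebra)"
  by (metis adj_adj adj_mult mult_1 mult_1_right)

lemma adj_minus: "(- x)\<^sup>\<star> = - (x::'a::unital_cstar_algebra)\<^sup>\<star>"
  using adj_add[of x "- x"] by (simp add: eq_neg_iff_add_eq_0 add.commute)

lemma adj_diff: "(x - y)\<^sup>\<star> = (x::'a::unital_cstar_algebra)\<^sup>\<star> - y\<^sup>\<star>"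
  using adj_add[of x "- y"] by (simp add: adj_minus)

lemma adj_scaleR: "(r *\<^sub>R x)\<^sup>\<star> = r *\<^sub>R (x::'a::unital_cstar_algebra)\<^sup>\<star>"
  by (simp add: scaleR_scaleC adj_scaleC)

lemma adj_power: "(x ^ n)\<^sup>\<star> = (x::'a::unital_cstar_algebra)\<^sup>\<star> ^ n"
  by (induction n) (simp_all add: adj_mult power_commutes)

lemma norm_adj: "norm (x\<^sup>\<star>) = norm (x::'a::unital_cstar_algebra)"
proof -
  have le: "norm y \<le> norm (y\<^sup>\<star>)" for y :: 'a
  proof (cases "y = 0")
    case False
    have "norm y * norm y \<le> norm (y\<^sup>\<star>) * norm y"
      using norm_mult_ineq[of "y\<^sup>\<star>" y] by (simp add: cstar_identity power2_eq_square)
    then show ?thesis using False by simp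
  qed simp
  show ?thesis using le[of x] le[of "x\<^sup>\<star>"] by (simp add: adj_adj)
qed

lemma bounded_linear_adj: "bounded_linear (adj :: 'a \<Rightarrow> 'a::unital_cstar_algebra)"
  by (rule bounded_linear_intro[where K = 1]) (simp_all add: adj_add adj_scaleR norm_adj)

lemma norm_one_le: "norm (1::'a::unital_cstar_algebra) \<le> 1"
  using cstar_identity[of "1::'a"] by (auto simp: power2_eq_square)

lemma norm_power_le_one:
  fixes x :: "'a::unital_cstar_algebra"
  assumes "norm x \<le> 1"
  shows "norm (x ^ n) \<le> 1"
proof (induction n)
  case 0
  then show ?case by (simp add: norm_one_le)
next
  case (Suc n)
  have "norm (x ^ Suc n) \<le> norm x * norm (x ^ n)" by (simp add: norm_mult_ineq)
  also have "\<dots> \<le> 1" using assms Suc by (simp add: mult_le_one)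
  finally show ?case .
qed

lemma adj_mult_self_eq_0: "x\<^sup>\<star> * x = 0 \<longleftrightarrow> (x::'a::unital_cstar_algebra) = 0"
  using cstar_identity[of x] by auto

lemma selfadjoint_square_eq_0:
  fixes x :: "'a::unital_cstar_algebra"
  assumes "x\<^sup>\<star> = x" "x * x = 0"
  shows "x = 0"
  using adj_mult_self_eq_0[of x] assms by simp

lemma adj_mult_self_cartesian:
  fixes p q :: "'a::unital_cstar_algebra"
  assumes "p\<^sup>\<star> = p" "q\<^sup>\<star> = q"
  shows "(p + \<i> *\<^sub>C q)\<^sup>\<star> * (p + \<i> *\<^sub>C q) = p * p + q * q + \<i> *\<^sub>C (p * q - q * p)"
  using assms
  by (simp add: adj_add adj_scaleC distrib_left distrib_right mult_scaleC_left mult_scaleC_right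
      scaleC_scaleC scaleC.scale_right_diff_distrib left_diff_distrib)

lemma cartesian_decomposition:
  fixes x :: "'a::unital_cstar_algebra"
  obtains p q where "p\<^sup>\<star> = p" "q\<^sup>\<star> = q" "x = p + \<i> *\<^sub>C q"
proof
  show "((1/2) *\<^sub>C (x + x\<^sup>\<star>))\<^sup>\<star> = (1/2) *\<^sub>C (x + x\<^sup>\<star>)"
    by (simp add: adj_scaleC adj_add adj_adj add.commute)
  show "((-\<i>/2) *\<^sub>C (x - x\<^sup>\<star>))\<^sup>\<star> = (-\<i>/2) *\<^sub>C (x - x\<^sup>\<star>)"
    by (simp add: adj_scaleC adj_diff adj_adj scaleC.scale_right_diff_distrib)
  have "x = (1/2 + 1/2) *\<^sub>C x" by simp
  also have "\<dots> = (1/2) *\<^sub>C x + (1/2) *\<^sub>C x" by (rule scaleC_add_left)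
  finally show "x = (1/2) *\<^sub>C (x + x\<^sup>\<star>) + \<i> *\<^sub>C ((-\<i>/2) *\<^sub>C (x - x\<^sup>\<star>))"
    by (simp add: scaleC_scaleC scaleC_add_right scaleC.scale_right_diff_distrib)
qed

section \<open>Square roots by the binomial series\<close>

definition sqrt_coeff :: "nat \<Rightarrow> real" where
  "sqrt_coeff n = (1/2 gchoose n) * (-1) ^ n"

lemma sqrt_coeff_0 [simp]: "sqrt_coeff 0 = 1"
  by (simp add: sqrt_coeff_def)

lemma sqrt_coeff_Suc_nonpos: "sqrt_coeff (Suc n) \<le> 0"
proof -
  have "sqrt_coeff (Suc n) = pochhammer (-1/2) (Suc n) / fact (Suc n)"
    by (simp add: sqrt_coeff_def gbinomial_pochhammer del: pochhammer_Suc fact_Suc)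
  also have "pochhammer (-1/2::real) (Suc n) = (-1/2) * pochhammer (1/2) n"
    by (simp add: pochhammer_rec)
  finally show ?thesis
    using pochhammer_nonneg[of "1/2::real" n]
    by (simp add: divide_nonpos_pos mult_nonneg_nonneg del: fact_Suc)
qed

lemma sum_sqrt_coeff_nonneg: "0 \<le> (\<Sum>k\<le>n. sqrt_coeff k)"
proof -
  have "(\<Sum>k\<le>n. sqrt_coeff k) = (-1) ^ n * (1/2 - 1 gchoose n)"
    unfolding sqrt_coeff_def by (rule gbinomial_sum_lower_neg)
  also have "\<dots> = pochhammer (1/2) n / fact n"
    by (simp add: gbinomial_pochhammer)
  finally show ?thesis using pochhammer_nonneg[of "1/2::real" n] by simp
qed

lemma sum_abs_sqrt_coeff_Suc_le: "(\<Sum>k<n. \<bar>sqrt_coeff (Suc k)\<bar>) \<le> 1"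
proof -
  have "(\<Sum>k\<le>n. sqrt_coeff k) = 1 - (\<Sum>k<n. \<bar>sqrt_coeff (Suc k)\<bar>)"
    by (simp add: sum.atMost_shift sqrt_coeff_Suc_nonpos sum_negf)
  then show ?thesis using sum_sqrt_coeff_nonneg[of n] by simp
qed

lemma summable_abs_sqrt_coeff_Suc: "summable (\<lambda>n. \<bar>sqrt_coeff (Suc n)\<bar>)"
  by (rule summableI_nonneg_bounded[where x = 1]) (simp_all add: sum_abs_sqrt_coeff_Suc_le)

lemma sqrt_coeff_convolution:
  "(\<Sum>k\<le>n. sqrt_coeff k * sqrt_coeff (n - k)) = (if n = 0 then 1 else if n = 1 then -1 else 0)"
proof -
  have "(\<Sum>k\<le>n. sqrt_coeff k * sqrt_coeff (n - k)) =
      (\<Sum>k\<le>n. (1/2 gchoose k) * (1/2 gchoose (n - k))) * (-1) ^ n"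
    unfolding sum_distrib_right sqrt_coeff_def
    by (rule sum.cong) (auto simp: mult_ac simp flip: power_add)
  also have "(\<Sum>k\<le>n. (1/2 gchoose k) * (1/2 gchoose (n - k))) = (1/2 + 1/2 :: real) gchoose n"
    by (simp only: gbinomial_Vandermonde[symmetric] atLeast0AtMost)
  also have "\<dots> = of_nat (1 choose n)" by (simp add: binomial_gbinomial)
  finally show ?thesis by (cases n) (auto simp: binomial_eq_0)
qed

lemma sqrt_one_minus_exists:
  fixes h :: "'a::unital_cstar_algebra"
  assumes sa: "h\<^sup>\<star> = h" and nh: "norm h \<le> 1"
  obtains s where "s\<^sup>\<star> = s" "s * s = 1 - h" "norm (1 - s) \<le> 1"
    "\<And>x. x * h = h * x \<Longrightarrow> x * s = s * x"
proof
  define f where "f n = sqrt_coeff n *\<^sub>R h ^ n" for n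
  define s where "s = suminf f"
  have nf: "norm (f n) \<le> \<bar>sqrt_coeff n\<bar>" for n
    using norm_power_le_one[OF nh, of n] by (simp add: f_def mult_left_le)
  have "summable (\<lambda>n. norm (f (Suc n)))"
    by (rule summable_comparison_test'[OF summable_abs_sqrt_coeff_Suc, of 0]) (use nf in auto)
  then have snf: "summable (\<lambda>n. norm (f n))"
    using summable_Suc_iff[of "\<lambda>n. norm (f n)"] by simp
  then have sf: "summable f" by (rule summable_norm_cancel)
  show "s\<^sup>\<star> = s"
    unfolding s_def bounded_linear.suminf[OF bounded_linear_adj sf]
    by (simp add: f_def[abs_def] adj_scaleR adj_power sa)
  show "x * s = s * x" if "x * h = h * x" for x
  proof -
    have "x * h ^ n = h ^ n * x" for n
      by (induction n) (simp_all, metis mult.assoc that)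
    then have "x * f n = f n * x" for n by (simp add: f_def)
    then show ?thesis
      unfolding s_def by (simp add: suminf_mult[OF sf, symmetric] suminf_mult2[OF sf])
  qed
  have "(\<Sum>k\<le>n. f k * f (n - k)) =
      (if n = 0 then 1 else if n = 1 then -1 else (0::real)) *\<^sub>R h ^ n" for n
    unfolding sqrt_coeff_convolution[symmetric] scaleR_sum_left
    by (rule sum.cong) (auto simp: f_def simp flip: power_add)
  then have "s * s = (\<Sum>n. (if n = 0 then 1 else if n = 1 then -1 else (0::real)) *\<^sub>R h ^ n)"
    unfolding s_def by (simp add: Cauchy_product[OF snf snf])
  also have "\<dots> = (\<Sum>n\<in>{0, 1}. (if n = 0 then 1 else if n = 1 then -1 else (0::real)) *\<^sub>R h ^ n)"
    by (rule suminf_finite) auto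
  finally show "s * s = 1 - h" by simp
  have "1 - s = - (\<Sum>n. f (Suc n))"
    unfolding s_def suminf_split_head[OF sf] by (simp add: f_def)
  then have "norm (1 - s) = norm (\<Sum>n. f (Suc n))" by simp
  also have "\<dots> \<le> (\<Sum>n. \<bar>sqrt_coeff (Suc n)\<bar>)"
    by (rule norm_suminf_le[OF nf summable_abs_sqrt_coeff_Suc])
  also have "\<dots> \<le> 1"
    by (rule suminf_le_const[OF summable_abs_sqrt_coeff_Suc sum_abs_sqrt_coeff_Suc_le])
  finally show "norm (1 - s) \<le> 1" .
qed

section \<open>The positive cone\<close>

definition pos_cone :: "'a::unital_cstar_algebra set" where
  "pos_cone = {a. a\<^sup>\<star> = a \<and> (\<exists>t\<ge>0. norm (t *\<^sub>R 1 - a) \<le> t)}"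

lemma pos_cone_selfadjoint: "a \<in> pos_cone \<Longrightarrow> a\<^sup>\<star> = a"
  by (simp add: pos_cone_def)

lemma pos_cone_add:
  assumes "a \<in> pos_cone" "b \<in> pos_cone"
  shows "a + b \<in> pos_cone"
proof -
  obtain s t where st: "s \<ge> 0" "norm (s *\<^sub>R 1 - a) \<le> s" "t \<ge> 0" "norm (t *\<^sub>R 1 - b) \<le> t"
    using assms by (auto simp: pos_cone_def)
  have eq: "(s + t) *\<^sub>R 1 - (a + b) = (s *\<^sub>R 1 - a) + (t *\<^sub>R 1 - b)"
    by (simp add: scaleR_add_left)
  have "norm ((s + t) *\<^sub>R 1 - (a + b)) \<le> s + t"
    unfolding eq using norm_triangle_ineq[of "s *\<^sub>R 1 - a" "t *\<^sub>R 1 - b"] st by linarith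
  then show ?thesis
    using assms st by (auto simp: pos_cone_def adj_add intro!: exI[of _ "s + t"])
qed

lemma pos_cone_scaleR:
  assumes "a \<in> pos_cone" "r \<ge> 0"
  shows "r *\<^sub>R a \<in> pos_cone"
proof -
  obtain t where t: "t \<ge> 0" "norm (t *\<^sub>R 1 - a) \<le> t"
    using assms by (auto simp: pos_cone_def)
  have "(r * t) *\<^sub>R 1 - r *\<^sub>R a = r *\<^sub>R (t *\<^sub>R 1 - a)"
    by (simp add: scaleR_diff_right)
  then have "norm ((r * t) *\<^sub>R 1 - r *\<^sub>R a) \<le> r * t"
    using t assms by (simp add: mult_left_mono)
  then show ?thesis
    using assms t by (auto simp: pos_cone_def adj_scaleR intro!: exI[of _ "r * t"])
qed

text \<open>If \<open>k = sqrt (1 - h\<^sup>2)\<close> then \<open>h + \<i>k\<close> is unitary, which bounds the norm of its imaginary part \<open>k\<close>.\<close>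

lemma norm_one_minus_square_le:
  fixes h :: "'a::unital_cstar_algebra"
  assumes sa: "h\<^sup>\<star> = h" and nh: "norm h \<le> 1"
  shows "norm (1 - h * h) \<le> 1"
proof -
  have "norm (h * h) \<le> 1"
    using norm_mult_ineq[of h h] nh by (meson mult_le_one norm_ge_zero order_trans)
  moreover have "(h * h)\<^sup>\<star> = h * h" by (simp add: adj_mult sa)
  ultimately obtain k where k: "k\<^sup>\<star> = k" "k * k = 1 - h * h" "norm (1 - k) \<le> 1"
    and comm: "\<And>x. x * (h * h) = (h * h) * x \<Longrightarrow> x * k = k * x"
    using sqrt_one_minus_exists by blast
  have hk: "h * k = k * h" by (rule comm) (simp add: mult.assoc)
  define u where "u = h + \<i> *\<^sub>C k"
  have "u\<^sup>\<star> * u = 1"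
    unfolding u_def using adj_mult_self_cartesian[OF sa k(1)] by (simp add: hk k)
  then have "(norm u)\<^sup>2 \<le> 1"
    using cstar_identity[of u] norm_one_le[where 'a = 'a] by simp
  then have nu: "norm u \<le> 1" by (simp add: abs_square_le_1)
  have "u - u\<^sup>\<star> = (2 * \<i>) *\<^sub>C k"
    using scaleC_add_left[of \<i> \<i> k] by (simp add: u_def adj_add adj_scaleC sa k)
  then have "norm (u - u\<^sup>\<star>) = 2 * norm k" by (simp add: norm_scaleC norm_mult)
  moreover have "norm (u - u\<^sup>\<star>) \<le> 2"
    using norm_triangle_ineq4[of u "u\<^sup>\<star>"] nu by (simp add: norm_adj)
  ultimately have "norm k \<le> 1" by simp
  then have "norm (k * k) \<le> 1"
    by (meson mult_le_one norm_ge_zero norm_mult_ineq order_trans)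
  then show ?thesis by (simp add: k)
qed

lemma square_in_pos_cone:
  fixes h :: "'a::unital_cstar_algebra"
  assumes sa: "h\<^sup>\<star> = h"
  shows "h * h \<in> pos_cone"
proof -
  define r where "r = norm h + 1"
  have r: "r > 0" by (simp add: r_def add_nonneg_pos)
  define g where "g = (1 / r) *\<^sub>R h"
  have g: "g\<^sup>\<star> = g" by (simp add: g_def adj_scaleR sa)
  moreover have "norm g \<le> 1" using r by (simp add: g_def r_def)
  ultimately have "norm (1 - g * g) \<le> 1" by (rule norm_one_minus_square_le)
  then have "g * g \<in> pos_cone"
    by (auto simp: pos_cone_def adj_mult g intro!: exI[of _ 1])
  then have "(r * r) *\<^sub>R (g * g) \<in> pos_cone"
    by (rule pos_cone_scaleR) simp
  then show ?thesis using r by (simp add: g_def)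
qed

lemma pos_cone_sqrt:
  fixes a :: "'a::unital_cstar_algebra"
  assumes a: "a \<in> pos_cone"
  obtains s where "s \<in> pos_cone" "s * s = a" "\<And>x. x * a = a * x \<Longrightarrow> x * s = s * x"
proof -
  obtain t where t: "t \<ge> 0" "norm (t *\<^sub>R 1 - a) \<le> t"
    using a by (auto simp: pos_cone_def)
  show thesis
  proof (cases "t = 0")
    case True
    then have "a = 0" using t by simp
    then show thesis using a that[of 0] by simp
  next
    case False
    then have t0: "t > 0" using t by simp
    define h where "h = 1 - (1/t) *\<^sub>R a"
    have "h = (1/t) *\<^sub>R (t *\<^sub>R 1 - a)" using t0 by (simp add: h_def scaleR_diff_right)
    then have "norm h \<le> 1" using t t0 by simp
    moreover have "h\<^sup>\<star> = h" using a by (simp add: h_def adj_diff adj_scaleR pos_cone_selfadjoint)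
    ultimately obtain s where s: "s\<^sup>\<star> = s" "s * s = 1 - h" "norm (1 - s) \<le> 1"
      and comm: "\<And>x. x * h = h * x \<Longrightarrow> x * s = s * x"
      using sqrt_one_minus_exists by blast
    show thesis
    proof (rule that[of "sqrt t *\<^sub>R s"])
      have "s \<in> pos_cone" using s by (auto simp: pos_cone_def intro!: exI[of _ 1])
      then show "sqrt t *\<^sub>R s \<in> pos_cone" using t by (simp add: pos_cone_scaleR)
      show "sqrt t *\<^sub>R s * sqrt t *\<^sub>R s = a" using t0 s(2) by (simp add: h_def)
      show "x * sqrt t *\<^sub>R s = sqrt t *\<^sub>R s * x" if "x * a = a * x" for x
        using comm[of x] that by (simp add: h_def right_diff_distrib left_diff_distrib)
    qed
  qed
qed

text \<open>The two square roots commute, so \<open>s + \<i>k\<close> satisfies \<open>(s + \<i>k)\<^sup>\<star>(s + \<i>k) = s\<^sup>2 + k\<^sup>2 = 0\<close>.\<close>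

lemma pos_cone_pointed:
  fixes a :: "'a::unital_cstar_algebra"
  assumes "a \<in> pos_cone" "- a \<in> pos_cone"
  shows "a = 0"
proof -
  obtain s where s: "s \<in> pos_cone" "s * s = a" "\<And>x. x * a = a * x \<Longrightarrow> x * s = s * x"
    using pos_cone_sqrt[OF assms(1)] by blast
  obtain k where k: "k \<in> pos_cone" "k * k = - a" "\<And>x. x * (- a) = (- a) * x \<Longrightarrow> x * k = k * x"
    using pos_cone_sqrt[OF assms(2)] by blast
  have "s * k = k * s" by (rule k(3)) (simp add: s(2)[symmetric] mult.assoc)
  have "(s + \<i> *\<^sub>C k)\<^sup>\<star> * (s + \<i> *\<^sub>C k) = 0"
    using s(1,2) k(1,2) \<open>s * k = k * s\<close> by (simp add: adj_mult_self_cartesian pos_cone_selfadjoint)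
  then have 0: "s + \<i> *\<^sub>C k = 0" by (simp add: adj_mult_self_eq_0)
  then have "(s + \<i> *\<^sub>C k)\<^sup>\<star> = 0" by simp
  then have "s - \<i> *\<^sub>C k = 0"
    using s(1) k(1) by (simp add: adj_add adj_scaleC pos_cone_selfadjoint)
  with 0 have "s + s = 0"
    by (metis add_cancel_left_left diff_add_cancel)
  then have "s = 0" by (simp flip: scaleR_2)
  then show ?thesis using s(2) by simp
qed

lemma pos_cone_add_eq_0:
  assumes "a \<in> pos_cone" "b \<in> pos_cone" "a + b = 0"
  shows "a = 0"
  using assms pos_cone_pointed[of a] by (simp add: eq_neg_iff_add_eq_0 add.commute minus_unique)

lemma adj_mult_self_add_in_pos_cone:
  fixes z :: "'a::unital_cstar_algebra"
  shows "z\<^sup>\<star> * z + z * z\<^sup>\<star> \<in> pos_cone"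
proof -
  obtain p q where pq: "p\<^sup>\<star> = p" "q\<^sup>\<star> = q" "z = p + \<i> *\<^sub>C q"
    by (rule cartesian_decomposition)
  have "z * z\<^sup>\<star> = p * p + q * q - \<i> *\<^sub>C (p * q - q * p)"
    using pq by (simp add: adj_add adj_scaleC distrib_left distrib_right mult_scaleC_left
        mult_scaleC_right scaleC_scaleC scaleC.scale_right_diff_distrib algebra_simps)
  moreover have "z\<^sup>\<star> * z = p * p + q * q + \<i> *\<^sub>C (p * q - q * p)"
    unfolding pq(3) by (rule adj_mult_self_cartesian[OF pq(1,2)])
  ultimately have "z\<^sup>\<star> * z + z * z\<^sup>\<star> = (p * p + q * q) + (p * p + q * q)" by simp
  then show ?thesis using pq by (simp add: pos_cone_add square_in_pos_cone)
qed

text \<open>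
  With \<open>- w\<^sup>\<star>w = k\<^sup>2\<close> and \<open>z = wk\<close>, both \<open>z\<^sup>\<star>z = - (k\<^sup>2)\<^sup>2\<close> and \<open>zz\<^sup>\<star> = - (ww\<^sup>\<star>)\<^sup>2\<close> are negative,
  while their sum is positive. This replaces the comparison of the spectra of \<open>w\<^sup>\<star>w\<close> and \<open>ww\<^sup>\<star>\<close>.
\<close>

lemma neg_adj_mult_self_in_pos_cone:
  fixes w :: "'a::unital_cstar_algebra"
  assumes "- (w\<^sup>\<star> * w) \<in> pos_cone"
  shows "w = 0"
proof -
  obtain k where k: "k \<in> pos_cone" "k * k = - (w\<^sup>\<star> * w)"
    using pos_cone_sqrt[OF assms] by blast
  have ksa: "k\<^sup>\<star> = k" using k by (simp add: pos_cone_selfadjoint)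
  define z where "z = w * k"
  have "z\<^sup>\<star> * z = k * (w\<^sup>\<star> * w) * k" by (simp add: z_def adj_mult ksa mult.assoc)
  also have "w\<^sup>\<star> * w = - (k * k)" using k by simp
  finally have 1: "z\<^sup>\<star> * z = - ((k * k) * (k * k))" by (simp add: mult.assoc)
  have "z * z\<^sup>\<star> = w * (k * k) * w\<^sup>\<star>" by (simp add: z_def adj_mult ksa mult.assoc)
  also have "\<dots> = - ((w * w\<^sup>\<star>) * (w * w\<^sup>\<star>))" by (simp add: k mult.assoc)
  finally have 2: "z * z\<^sup>\<star> = - ((w * w\<^sup>\<star>) * (w * w\<^sup>\<star>))" .
  have kk: "(k * k)\<^sup>\<star> = k * k" by (simp add: adj_mult ksa)
  have pk: "(k * k) * (k * k) \<in> pos_cone" by (rule square_in_pos_cone[OF kk])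
  have pw: "(w * w\<^sup>\<star>) * (w * w\<^sup>\<star>) \<in> pos_cone"
    by (rule square_in_pos_cone) (simp add: adj_mult adj_adj)
  have "(k * k) * (k * k) + ((w * w\<^sup>\<star>) * (w * w\<^sup>\<star>) + (z\<^sup>\<star> * z + z * z\<^sup>\<star>)) = 0"
    by (simp add: 1 2)
  then have "(k * k) * (k * k) = 0"
    using pos_cone_add_eq_0 pos_cone_add adj_mult_self_add_in_pos_cone pk pw by metis
  then have "k * k = 0" by (rule selfadjoint_square_eq_0[OF kk])
  then show ?thesis using k by (simp add: adj_mult_self_eq_0)
qed

text \<open>
  Here \<open>m\<close> is the absolute value of \<open>a = x\<^sup>\<star>x\<close> and \<open>v\<close> is twice the negative part of \<open>a\<close>; the
  preceding lemma, applied to \<open>xv\<close>, shows \<open>v = 0\<close>.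
\<close>

lemma adj_mult_self_in_pos_cone:
  fixes x :: "'a::unital_cstar_algebra"
  shows "x\<^sup>\<star> * x \<in> pos_cone"
proof -
  define a where "a = x\<^sup>\<star> * x"
  have asa: "a\<^sup>\<star> = a" by (simp add: a_def adj_mult adj_adj)
  obtain m where m: "m \<in> pos_cone" "m * m = a * a" "\<And>y. y * (a * a) = (a * a) * y \<Longrightarrow> y * m = m * y"
    using pos_cone_sqrt[OF square_in_pos_cone[OF asa]] by blast
  obtain n where n: "n \<in> pos_cone" "n * n = m" "\<And>y. y * m = m * y \<Longrightarrow> y * n = n * y"
    using pos_cone_sqrt[OF m(1)] by blast
  have am: "a * m = m * a" by (rule m(3)) (simp add: mult.assoc)
  define v where "v = m - a"
  have vsa: "v\<^sup>\<star> = v" by (simp add: v_def adj_diff asa pos_cone_selfadjoint[OF m(1)])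
  have vn: "v * n = n * v"
    by (rule n(3)) (simp add: v_def left_diff_distrib right_diff_distrib am)
  have av: "a * v = - (m * v)"
    by (simp add: v_def right_diff_distrib am m)
  have nv: "(n * v)\<^sup>\<star> = n * v"
    by (simp add: adj_mult vsa pos_cone_selfadjoint[OF n(1)] vn)
  have "(x * v)\<^sup>\<star> * (x * v) = v * (a * v)"
    by (simp add: adj_mult vsa a_def mult.assoc)
  also have "\<dots> = - ((v * n) * (n * v))"
    by (simp add: av mult.assoc flip: n(2))
  finally have xv: "(x * v)\<^sup>\<star> * (x * v) = - ((n * v) * (n * v))" by (simp add: vn)
  then have "- ((x * v)\<^sup>\<star> * (x * v)) \<in> pos_cone"
    by (simp add: square_in_pos_cone[OF nv])
  then have "x * v = 0" by (rule neg_adj_mult_self_in_pos_cone)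
  then have av0: "a * v = 0" by (simp add: a_def mult.assoc)
  then have "v * v = 0" using av by (simp add: v_def left_diff_distrib)
  then have "v = 0" by (rule selfadjoint_square_eq_0[OF vsa])
  then show ?thesis using m(1) by (simp add: v_def a_def)
qed

lemma positive_elem_in_pos_cone: "positive_elem a \<Longrightarrow> a \<in> pos_cone"
  by (auto simp: positive_elem_def adj_mult_self_in_pos_cone)

section \<open>Schwarz-positive unital maps\<close>

text \<open>Polarization: \<open>2(x + x\<^sup>\<star>) = (x + 1)\<^sup>\<star>(x + 1) - (x - 1)\<^sup>\<star>(x - 1)\<close>, and \<open>F (b\<^sup>\<star>b)\<close> is self-adjoint.\<close>

lemma SPU_adj:
  fixes F :: "'a::unital_cstar_algebra \<Rightarrow> 'b::unital_cstar_algebra"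
  assumes "SPU F"
  shows "F (x\<^sup>\<star>) = (F x)\<^sup>\<star>"
proof -
  interpret F: Vector_Spaces.linear scaleC scaleC F
    using assms by (simp add: SPU_def)
  have sq: "(F (b\<^sup>\<star> * b))\<^sup>\<star> = F (b\<^sup>\<star> * b)" for b
  proof -
    obtain c where "F (b\<^sup>\<star> * b) - (F b)\<^sup>\<star> * F b = c\<^sup>\<star> * c"
      using assms by (auto simp: SPU_def cstar_le_def positive_elem_def)
    then have "F (b\<^sup>\<star> * b) = c\<^sup>\<star> * c + (F b)\<^sup>\<star> * F b" by (simp add: diff_eq_eq)
    then show ?thesis by (simp add: adj_add adj_mult adj_adj)
  qed
  have re: "(F y + F (y\<^sup>\<star>))\<^sup>\<star> = F y + F (y\<^sup>\<star>)" for y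
  proof -
    have "(y + 1)\<^sup>\<star> * (y + 1) - (y - 1)\<^sup>\<star> * (y - 1) = (y + y\<^sup>\<star>) + (y + y\<^sup>\<star>)"
      by (simp add: adj_add adj_diff algebra_simps)
    also have "\<dots> = 2 *\<^sub>C (y + y\<^sup>\<star>)"
      using scaleC_add_left[of 1 1 "y + y\<^sup>\<star>"] by simp
    finally have "F ((y + 1)\<^sup>\<star> * (y + 1)) - F ((y - 1)\<^sup>\<star> * (y - 1)) = 2 *\<^sub>C (F y + F (y\<^sup>\<star>))"
      by (metis F.diff F.add F.scale)
    then have "(2 *\<^sub>C (F y + F (y\<^sup>\<star>)))\<^sup>\<star> = 2 *\<^sub>C (F y + F (y\<^sup>\<star>))"
      by (metis adj_diff sq)
    then show ?thesis by (simp add: adj_scaleC)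
  qed
  have "\<i> *\<^sub>C (F (x\<^sup>\<star>) - F x) = \<i> *\<^sub>C ((F x)\<^sup>\<star> - (F (x\<^sup>\<star>))\<^sup>\<star>)"
    using re[of "\<i> *\<^sub>C x"]
    by (simp add: adj_add adj_scaleC adj_minus adj_diff F.scale F.neg scaleC.scale_right_diff_distrib algebra_simps)
  then have im: "F (x\<^sup>\<star>) - F x = (F x)\<^sup>\<star> - (F (x\<^sup>\<star>))\<^sup>\<star>" by simp
  have "F (x\<^sup>\<star>) + F (x\<^sup>\<star>) = (F (x\<^sup>\<star>) - F x) + (F x + F (x\<^sup>\<star>))" by simp
  also have "\<dots> = (F x)\<^sup>\<star> + (F x)\<^sup>\<star>"
    unfolding im using re[of x] by (simp add: adj_add algebra_simps)
  finally have "(2::real) *\<^sub>R F (x\<^sup>\<star>) = 2 *\<^sub>R (F x)\<^sup>\<star>" by (simp add: scaleR_2)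
  then show ?thesis by simp
qed

theorem lemma8p17:
  fixes \<xi> :: "'b::unital_cstar_algebra \<Rightarrow> 'c::unital_cstar_algebra"
    and F :: "'b \<Rightarrow> 'a::unital_cstar_algebra"
    and G :: "'a \<Rightarrow> 'b"
  assumes "positive_linear_map \<xi>"
    and "SPU F"
    and "SPU G"
    and "ae_equiv \<xi> (G \<circ> F) id"
  shows "\<forall>B. \<xi> (B\<^sup>\<star> * B) = \<xi> ((G (F B))\<^sup>\<star> * G (F B))
           \<and> \<xi> ((G (F B))\<^sup>\<star> * G (F B)) = \<xi> (G ((F B)\<^sup>\<star> * F B))
           \<and> \<xi> (G ((F B)\<^sup>\<star> * F B)) = \<xi> (G (F (B\<^sup>\<star> * B)))"
proof
  fix B
  interpret xi: Vector_Spaces.linear scaleC scaleC \<xi>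
    using assms by (simp add: positive_linear_map_def)
  interpret G: Vector_Spaces.linear scaleC scaleC G
    using assms by (simp add: SPU_def)
  have xi_pos: "\<xi> (b\<^sup>\<star> * b) \<in> pos_cone" for b
    using assms(1) by (metis positive_linear_map_def positive_elem_def positive_elem_in_pos_cone)
  have ae: "\<xi> (G (F X) * Y) = \<xi> (X * Y)" "\<xi> (Y * G (F X)) = \<xi> (Y * X)" for X Y
    using assms(4) by (simp_all add: ae_equiv_def)
  have GF_adj: "G (F (B\<^sup>\<star>)) = (G (F B))\<^sup>\<star>"
    using assms by (simp add: SPU_adj)
  have outer: "\<xi> (G (F (B\<^sup>\<star> * B))) = \<xi> (B\<^sup>\<star> * B)"
    using ae(1)[of "B\<^sup>\<star> * B" 1] by simp
  have inner: "\<xi> ((G (F B))\<^sup>\<star> * G (F B)) = \<xi> (B\<^sup>\<star> * B)"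
    using ae(2)[of "(G (F B))\<^sup>\<star>" B] ae(1)[of "B\<^sup>\<star>" B] by (simp add: GF_adj)
  have schwarz_F: "\<exists>c. F (b\<^sup>\<star> * b) = (F b)\<^sup>\<star> * F b + c\<^sup>\<star> * c" for b
    using assms(2) by (simp add: SPU_def cstar_le_def positive_elem_def diff_eq_eq add.commute)
  have schwarz_G: "\<exists>c. G (b\<^sup>\<star> * b) = (G b)\<^sup>\<star> * G b + c\<^sup>\<star> * c" for b
    using assms(3) by (simp add: SPU_def cstar_le_def positive_elem_def diff_eq_eq add.commute)
  obtain p where p: "G ((F B)\<^sup>\<star> * F B) = (G (F B))\<^sup>\<star> * G (F B) + p\<^sup>\<star> * p"
    using schwarz_G by blast
  obtain q where q: "F (B\<^sup>\<star> * B) = (F B)\<^sup>\<star> * F B + q\<^sup>\<star> * q"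
    using schwarz_F by blast
  obtain r where r: "G (q\<^sup>\<star> * q) = (G q)\<^sup>\<star> * G q + r\<^sup>\<star> * r"
    using schwarz_G by blast
  have "\<xi> (G (F (B\<^sup>\<star> * B))) = \<xi> ((G (F B))\<^sup>\<star> * G (F B)) +
      (\<xi> (p\<^sup>\<star> * p) + (\<xi> ((G q)\<^sup>\<star> * G q) + \<xi> (r\<^sup>\<star> * r)))"
    by (simp add: p q r xi.add G.add add.assoc)
  then have "\<xi> (p\<^sup>\<star> * p) + (\<xi> ((G q)\<^sup>\<star> * G q) + \<xi> (r\<^sup>\<star> * r)) = 0"
    by (simp add: outer inner)
  then have "\<xi> (p\<^sup>\<star> * p) = 0"
    by (meson pos_cone_add pos_cone_add_eq_0 xi_pos)
  then have "\<xi> (G ((F B)\<^sup>\<star> * F B)) = \<xi> ((G (F B))\<^sup>\<star> * G (F B))"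
    by (simp add: p xi.add)
  then show "\<xi> (B\<^sup>\<star> * B) = \<xi> ((G (F B))\<^sup>\<star> * G (F B))
           \<and> \<xi> ((G (F B))\<^sup>\<star> * G (F B)) = \<xi> (G ((F B)\<^sup>\<star> * F B))
           \<and> \<xi> (G ((F B)\<^sup>\<star> * F B)) = \<xi> (G (F (B\<^sup>\<star> * B)))"
    by (simp add: inner outer)
qed

end
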